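(* Let $m,n\in\mathbb{N}$ with $n\ge m$, and let $v,\delta$ be such that $\delta$ and $v-\delta$ are admissible orders. Then $$\frac{\partial^{m}}{\partial x^{m}}\bigl[{}_{T}B_{n}^{(c,v)}(x,y,z;\lambda)\bigr]=\sum_{r=0}^{n-m}m!\binom{n}{m}\binom{n-m}{r}B_{r}^{(\delta)}(\lambda)\,{}_{T}B_{n-r-m}^{(c,v-\delta)}(x,y,z;\lambda)$$ and $$\frac{\partial^{m}}{\partial x^{m}}\bigl[{}_{T}B_{n}^{(s,v)}(x,y,z;\lambda)\bigr]=\sum_{r=0}^{n-m}m!\binom{n}{m}\binom{n-m}{r}B_{r}^{(\delta)}(\lambda)\,{}_{T}B_{n-r-m}^{(s,v-\delta)}(x,y,z;\lambda).$$
   Context: $\mathbb{N}=\{1,2,3,\dots\}$, $\mathbb{N}_0=\mathbb{N}\cup\{0\}$; $x,y,z$ are variables (taking complex values) and $\lambda\in\mathbb{C}\setminus\{0\}$. Let $\mathcal{U}(y,t)=\sum_{n\ge0}\mathcal{U}_n(y)\frac{t^n}{n!}$ be a power series in $t$ with coefficients depending on $y$ and $\mathcal{U}_0(y)\neq0$; the 2-variable general polynomials $T_n(x,y)$ are defined by $e^{xt}\mathcal{U}(y,t)=\sum_{n\ge0}T_n(x,y)\frac{t^n}{n!}$, with the normalization $T_0(x,y)=1$. A number $v$ is an admissible order if $\bigl(\frac{t}{\lambda e^t-1}\bigr)^v$ is a power series in $t$ ($v\in\mathbb{N}_0$ in general; every $v\in\mathbb{C}$ is admissible when $\lambda=1$,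 with the branch $1^v=1$ at $t=0$). For an admissible order $v$, the parametric kinds of generalized Apostol--Bernoulli polynomials are defined, as power series in $t$, by $$\Bigl(\frac{t}{\lambda e^t-1}\Bigr)^v e^{xt}\,\mathcal{U}(y,t)\cos(zt)=\sum_{n=0}^\infty {}_{T}B_{n}^{(c,v)}(x,y,z;\lambda)\frac{t^n}{n!},$$ $$\Bigl(\frac{t}{\lambda e^t-1}\Bigr)^v e^{xt}\,\mathcal{U}(y,t)\sin(zt)=\sum_{n=0}^\infty {}_{T}B_{n}^{(s,v)}(x,y,z;\lambda)\frac{t^n}{n!}.$$ The Apostol--Bernoulli numbers $B_n^{(v)}(\lambda)$ of order $v$ are defined by $\bigl(\frac{t}{\lambda e^t-1}\bigr)^v=\sum_{n=0}^\infty B_n^{(v)}(\lambda)\frac{t^n}{n!}$. *)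

theory Defs
  imports "HOL-Complex_Analysis.Complex_Analysis"
begin

definition egf_coeff :: "complex fps \<Rightarrow> nat \<Rightarrow> complex" where
  "egf_coeff f n = fact n * fps_nth f n"

(* The coefficients U_n(y) are arbitrary functions of y. *)
definition egf :: "(nat \<Rightarrow> complex \<Rightarrow> complex) \<Rightarrow> complex \<Rightarrow> complex fps" where
  "egf U y = Abs_fps (\<lambda>n. U n y / fact n)"

definition general_poly :: "(nat \<Rightarrow> complex \<Rightarrow> complex) \<Rightarrow> nat \<Rightarrow> complex \<Rightarrow> complex \<Rightarrow> complex" where
  "general_poly U n x y = egf_coeff (fps_exp x * egf U y) n"

(* Division of formal power series cancels the common factor t when lam = 1;
   see apostol_kernel_mult below. *)
definition apostol_kernel :: "complex \<Rightarrow> complex fps" where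
  "apostol_kernel lam = fps_X / (fps_const lam * fps_exp 1 - 1)"

(* Ordinary power for natural exponents, and otherwise the binomial series in f - 1,
   which is the branch with value 1 at t = 0; the latter is meaningful only if f has constant term 1. *)
definition fps_cpow :: "complex fps \<Rightarrow> complex \<Rightarrow> complex fps" where
  "fps_cpow f v = (if v \<in> \<nat> then f ^ (THE k. v = of_nat k) else fps_binomial v oo (f - 1))"

definition admissible_order :: "complex \<Rightarrow> complex \<Rightarrow> bool" where
  "admissible_order lam v \<longleftrightarrow> v \<in> \<nat> \<or> lam = 1"

definition apostol_bernoulli_number :: "complex \<Rightarrow> complex \<Rightarrow> nat \<Rightarrow> complex" where
  "apostol_bernoulli_number v lam n = egf_coeff (fps_cpow (apostol_kernel lam) v) n"

definition TB_cos :: "(nat \<Rightarrow> complex \<Rightarrow> complex) \<Rightarrow> complex \<Rightarrow> nat \<Rightarrow>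
    complex \<Rightarrow> complex \<Rightarrow> complex \<Rightarrow> complex \<Rightarrow> complex" where
  "TB_cos U v n x y z lam =
     egf_coeff (fps_cpow (apostol_kernel lam) v * fps_exp x * egf U y * fps_cos z) n"

definition TB_sin :: "(nat \<Rightarrow> complex \<Rightarrow> complex) \<Rightarrow> complex \<Rightarrow> nat \<Rightarrow>
    complex \<Rightarrow> complex \<Rightarrow> complex \<Rightarrow> complex \<Rightarrow> complex" where
  "TB_sin U v n x y z lam =
     egf_coeff (fps_cpow (apostol_kernel lam) v * fps_exp x * egf U y * fps_sin z) n"

lemma apostol_kernel_mult:
  "apostol_kernel lam * (fps_const lam * fps_exp 1 - 1) = fps_X"
proof -
  let ?d = "fps_const lam * fps_exp 1 - 1 :: complex fps"
  have "?d \<noteq> 0 \<and> subdegree ?d \<le> 1"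
  proof (cases "lam = 1")
    case True
    have "fps_nth ?d 1 \<noteq> 0" using True by simp
    then show ?thesis by (metis fps_zero_nth subdegree_leI)
  next
    case False
    have "fps_nth ?d 0 \<noteq> 0" using False by simp
    then show ?thesis by (metis fps_zero_nth subdegree_leI zero_le order.trans)
  qed
  then have "?d dvd fps_X" by (simp add: fps_dvd_iff)
  then show ?thesis by (simp add: apostol_kernel_def)
qed

lemma fps_cpow_of_nat: "fps_cpow f (of_nat k) = f ^ k"
  by (simp add: fps_cpow_def)

lemma fps_cpow_eq_binomial:
  fixes f :: "complex fps"
  assumes "fps_nth f 0 = 1"
  shows "fps_cpow f v = fps_binomial v oo (f - 1)"
proof (cases "v \<in> \<nat>")
  case True
  then obtain k where k: "v = of_nat k" by (auto elim: Nats_cases)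
  have 0: "fps_nth (f - 1) 0 = 0" using assms by simp
  have "fps_binomial v oo (f - 1) = ((1 + fps_X) oo (f - 1)) ^ k"
    unfolding k fps_binomial_of_nat using fps_compose_power[OF 0] by metis
  also have "(1 + fps_X) oo (f - 1) = f"
    using 0 by (simp add: fps_compose_add_distrib)
  finally show ?thesis by (simp add: k fps_cpow_of_nat)
qed (simp add: fps_cpow_def)

end

theory Submission
  imports Defs
begin

text \<open>
  Differentiating \<open>e\<^bsup>xt\<^esup>\<close> in \<open>x\<close> multiplies the generating function by \<open>t\<close>, so \<open>m\<close> derivatives
  just shift the coefficients by \<open>m\<close>. The kernel of order \<open>v\<close> is the product of the kernels of
  orders \<open>\<delta>\<close> and \<open>v - \<delta>\<close>, and the binomial convolution of the coefficients of the two factors is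
  the right-hand side.
\<close>

text \<open>Compare the coefficients of t in \<open>apostol_kernel_mult\<close>: as e^t - 1 starts
  with t, only the constant term of the kernel contributes.\<close>

lemma apostol_kernel_1_nth_0: "fps_nth (apostol_kernel 1) 0 = 1"
proof -
  have "fps_nth (apostol_kernel 1 * (fps_const 1 * fps_exp 1 - 1)) 1 = 1"
    by (simp only: apostol_kernel_mult fps_X_nth) simp
  then show ?thesis
    by (simp add: fps_mult_nth)
qed

text \<open>Constant term 1 makes every power, natural exponents included, a binomial series in f -
  1, so the addition law of \<open>fps_binomial\<close> carries over by composition.\<close>

lemma fps_cpow_add:
  assumes "fps_nth f 0 = 1"
  shows "fps_cpow f (a + b) = fps_cpow f a * fps_cpow f b"
  using assms
  by (simp add: fps_cpow_eq_binomial fps_binomial_add_mult fps_compose_mult_distrib)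

text \<open>For lam = 1 the kernel has constant term 1. Otherwise admissibility forces natural
  exponents, and this is the law of ordinary powers.\<close>

lemma fps_cpow_apostol_kernel_add:
  assumes "admissible_order lam a" "admissible_order lam b"
  shows "fps_cpow (apostol_kernel lam) (a + b) =
    fps_cpow (apostol_kernel lam) a * fps_cpow (apostol_kernel lam) b"
proof (cases "lam = 1")
  case True
  then show ?thesis
    by (simp add: fps_cpow_add apostol_kernel_1_nth_0)
next
  case False
  then obtain j k where "a = of_nat j" "b = of_nat k"
    using assms by (auto simp: admissible_order_def elim!: Nats_cases)
  moreover have "fps_cpow f (of_nat j + of_nat k) = f ^ j * f ^ k" for f
    by (simp add: fps_cpow_of_nat power_add flip: of_nat_add)
  ultimately show ?thesis
    by (simp add: fps_cpow_of_nat)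
qed

lemma egf_coeff_mult:
  "egf_coeff (f * g) n = (\<Sum>r = 0..n. of_nat (n choose r) * egf_coeff f r * egf_coeff g (n - r))"
  unfolding egf_coeff_def fps_mult_nth sum_distrib_left
  by (intro sum.cong refl) (simp add: binomial_fact field_simps)

lemma DERIV_fps_nth_mult_exp:
  fixes G :: "complex fps"
  shows "((\<lambda>x. fps_nth (G * fps_exp x) (Suc n)) has_field_derivative fps_nth (G * fps_exp x) n) (at x)"
proof -
  have exp_nth: "((\<lambda>x. fps_nth (fps_exp x) (Suc k)) has_field_derivative fps_nth (fps_exp x) k) (at x)"
    for k and x :: complex
  proof -
    have "((\<lambda>x. x ^ Suc k / fact (Suc k)) has_field_derivative of_nat (Suc k) * x ^ k / fact (Suc k)) (at x)"
      using DERIV_cdivide[OF DERIV_power[OF DERIV_ident, of "Suc k" x], of "fact (Suc k)"]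
      by (simp del: fact_Suc of_nat_Suc power_Suc)
    moreover have "of_nat (Suc k) * x ^ k / fact (Suc k) = x ^ k / fact k"
      by (simp add: fact_Suc del: of_nat_Suc)
    ultimately show ?thesis
      by (simp only: fps_exp_nth of_nat_fact)
  qed
  have "((\<lambda>x. fps_nth G i * fps_nth (fps_exp x) (Suc n - i))
      has_field_derivative fps_nth G i * fps_nth (fps_exp x) (n - i)) (at x)" if "i \<le> n" for i
    using DERIV_cmult[OF exp_nth[of "n - i" x], of "fps_nth G i"] that by (simp only: Suc_diff_le)
  \<comment> \<open>The summand i = \<open>Suc n\<close> is split off: it carries the constant term
    1 of \<open>fps_exp x\<close>, so its derivative is 0.\<close>
  then have "((\<lambda>x. (\<Sum>i = 0..n. fps_nth G i * fps_nth (fps_exp x) (Suc n - i)) + fps_nth G (Suc n))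
      has_field_derivative (\<Sum>i = 0..n. fps_nth G i * fps_nth (fps_exp x) (n - i)) + 0) (at x)"
    by (intro DERIV_add DERIV_sum DERIV_const) auto
  then show ?thesis
    by (simp add: fps_mult_nth)
qed

lemma higher_deriv_fps_nth_mult_exp:
  fixes G :: "complex fps"
  shows "(deriv ^^ m) (\<lambda>x. fps_nth (G * fps_exp x) (n + m)) = (\<lambda>x. fps_nth (G * fps_exp x) n)"
proof (induction m)
  case (Suc m)
  have "deriv (\<lambda>x. fps_nth (G * fps_exp x) (n + Suc m)) = (\<lambda>x. fps_nth (G * fps_exp x) (n + m))"
    by (intro ext DERIV_imp_deriv) (simp only: add_Suc_right DERIV_fps_nth_mult_exp)
  then show ?case
    \<comment> \<open>The innermost derivative is taken first, which leaves the induction hypothesis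
      with the same n.\<close>
    by (simp only: funpow_Suc_right o_apply Suc.IH)
qed simp

lemma higher_deriv_egf_coeff_mult_exp:
  assumes "m \<le> n"
  shows "(deriv ^^ m) (\<lambda>x. egf_coeff (G * fps_exp x) n) x =
    fact m * of_nat (n choose m) * egf_coeff (G * fps_exp x) (n - m)"
proof -
  \<comment> \<open>The factor n! is absorbed into the series that does not depend on x.\<close>
  have "egf_coeff (G * fps_exp x) n = fps_nth (fps_const (fact n) * G * fps_exp x) (n - m + m)" for x
    using assms by (simp add: egf_coeff_def mult.assoc)
  then have "(deriv ^^ m) (\<lambda>x. egf_coeff (G * fps_exp x) n) x
      = fps_nth (fps_const (fact n) * G * fps_exp x) (n - m)"
    by (simp only: higher_deriv_fps_nth_mult_exp)
  \<comment> \<open>Here n! = m! (n choose m) (n - m)!.\<close>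
  also have "\<dots> = fact m * of_nat (n choose m) * egf_coeff (G * fps_exp x) (n - m)"
    using assms by (simp add: egf_coeff_def mult.assoc binomial_fact)
  finally show ?thesis .
qed

text \<open>Once the derivatives are taken, the exponential is grouped with D, and the convolution
  runs over C and D e^(xt).\<close>

lemma higher_deriv_egf_coeff_convolution:
  assumes "m \<le> n"
  shows "(deriv ^^ m) (\<lambda>x. egf_coeff (C * D * fps_exp x) n) x =
    (\<Sum>r = 0..n - m. fact m * of_nat (n choose m) * of_nat ((n - m) choose r) *
       egf_coeff C r * egf_coeff (D * fps_exp x) (n - r - m))"
proof -
  have "(deriv ^^ m) (\<lambda>x. egf_coeff (C * D * fps_exp x) n) x
      = fact m * of_nat (n choose m) * egf_coeff (C * (D * fps_exp x)) (n - m)"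
    using higher_deriv_egf_coeff_mult_exp[OF assms, of "C * D" x] by (simp only: mult.assoc)
  also have "\<dots> = fact m * of_nat (n choose m) * (\<Sum>r = 0..n - m. of_nat ((n - m) choose r) *
      egf_coeff C r * egf_coeff (D * fps_exp x) (n - r - m))"
    by (simp only: egf_coeff_mult[of C] diff_diff_left add.commute[of m])
  finally show ?thesis
    by (simp only: sum_distrib_left mult.assoc)
qed

theorem theorem4p2:
  fixes U :: "nat \<Rightarrow> complex \<Rightarrow> complex"
    and x y z lam v \<delta> :: complex
    and m n :: nat
  assumes "\<And>y. U 0 y \<noteq> 0"
    and "\<And>x y. general_poly U 0 x y = 1"
    and "lam \<noteq> 0"
    and "1 \<le> m" and "m \<le> n"
    and "admissible_order lam \<delta>"
    and "admissible_order lam (v - \<delta>)"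
  shows "(deriv ^^ m) (\<lambda>x. TB_cos U v n x y z lam) x =
           (\<Sum>r = 0..n - m. fact m * of_nat (n choose m) * of_nat ((n - m) choose r) *
              apostol_bernoulli_number \<delta> lam r * TB_cos U (v - \<delta>) (n - r - m) x y z lam)
       \<and> (deriv ^^ m) (\<lambda>x. TB_sin U v n x y z lam) x =
           (\<Sum>r = 0..n - m. fact m * of_nat (n choose m) * of_nat ((n - m) choose r) *
              apostol_bernoulli_number \<delta> lam r * TB_sin U (v - \<delta>) (n - r - m) x y z lam)"
proof -
  let ?K = "fps_cpow (apostol_kernel lam)"
  have K: "?K v = ?K \<delta> * ?K (v - \<delta>)"
    using fps_cpow_apostol_kernel_add[OF assms(6,7)] by simp
  \<comment> \<open>W stands for the cosine or the sine series, so one argument serves both claims.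
    Both identities hold for every x, as \<open>split\<close> is used under the binder of the
    derivative.\<close>
  have split: "?K v * fps_exp x * egf U y * W = ?K \<delta> * (?K (v - \<delta>) * egf U y * W) * fps_exp x"
    and move: "?K (v - \<delta>) * fps_exp x * egf U y * W = ?K (v - \<delta>) * egf U y * W * fps_exp x"
    for W x
    by (simp_all only: K mult_ac)
  show ?thesis
    unfolding TB_cos_def TB_sin_def apostol_bernoulli_number_def split move
    using higher_deriv_egf_coeff_convolution[OF \<open>m \<le> n\<close>] by blast
qed

end
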